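(* Let $X = CGLS(T,\mu;a,b;\langle\cdot\rangle)$ be a Composed Grand Lebesgue Space with norm $\|f\|_X=\langle\, |f|_p\,\rangle$. Then $X$ is a complete, order continuous, rearrangement invariant Banach function space with the Fatou property.
   Context: Let $(T,\mathcal A,\mu)$ be a measurable space with a non-trivial sigma-finite measure $\mu$. For measurable $f:T\to\mathbb R$ put $|f|_p=\left(\int_T|f|^p\,d\mu\right)^{1/p}$, $p\ge1$. Let $1\le a<b\le\infty$ and let $\langle\cdot\rangle$ be a rearrangement invariant (function) norm on real functions defined on the interval $(a,b)$, not necessarily finite on all functions. The Composed Grand Lebesgue Space $X=CGLS(T,\mu;a,b;\langle\cdot\rangle)$ is the space of (classes of) measurable functions $f:T\to\mathbb R$ with $\|f\|_X:=\langle h\rangle<\infty$, where $h(p)=|f|_p$, $p\in(a,b)$. Standing assumption: the norm $\langle\cdot\rangle$ is order continuous, i.e. for every sequence of functions $g_n$ on $(a,b)$ with $\langle g_n\rangle<\infty$, $g_n(\cdot)\downarrow0$ implies $\langle g_n\rangle\downarrow0$. Order continuity of $X$: if $g_n\in X$ and $g_n(t)\downarrow0$ $\mu$-almost everywhere, then $\|g_n\|_X\downarrow0$. Fatou property: $0\le f_n\uparrow f$ $\mu$-a.e. implies $\|f_n\|_X\uparrow\|f\|_X$.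
   Formalization: The norm ⟨·⟩ on (a,b) is assumed to be a function norm with the Fatou property and local integrability; "Banach function space" includes that indicators of sets of finite measure lie in X only when ⟨1⟩ is finite (otherwise this fails, e.g. for L¹(a,∞), where X={0}). *)

theory Defs
  imports "HOL-Analysis.Analysis"
begin

text \<open>
  Function norms follow Bennett and Sharpley: they act on all measurable functions with values in
  \<open>[0,\<infinity>]\<close> and have the Fatou property. Their further axiom that indicators of sets of finite
  measure have finite norm is not part of the locale, since it is not satisfied by every Composed
  Grand Lebesgue Space (for \<open>b = \<infinity>\<close> and the norm of \<open>L\<^sub>1(a,\<infinity>)\<close> the space is \<open>{0}\<close>).
\<close>

locale function_norm =
  fixes M :: "'a measure" and \<rho> :: "('a \<Rightarrow> ennreal) \<Rightarrow> ennreal"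
  assumes zero_iff: "\<And>f. f \<in> borel_measurable M \<Longrightarrow> \<rho> f = 0 \<longleftrightarrow> (AE x in M. f x = 0)"
    and scale: "\<And>f c. f \<in> borel_measurable M \<Longrightarrow> 0 \<le> c \<Longrightarrow> \<rho> (\<lambda>x. ennreal c * f x) = ennreal c * \<rho> f"
    and triangle: "\<And>f g. f \<in> borel_measurable M \<Longrightarrow> g \<in> borel_measurable M \<Longrightarrow>
      \<rho> (\<lambda>x. f x + g x) \<le> \<rho> f + \<rho> g"
    and mono: "\<And>f g. f \<in> borel_measurable M \<Longrightarrow> g \<in> borel_measurable M \<Longrightarrow>
      (AE x in M. f x \<le> g x) \<Longrightarrow> \<rho> f \<le> \<rho> g"
    and fatou: "\<And>F f. (\<And>n. F n \<in> borel_measurable M) \<Longrightarrow> f \<in> borel_measurable M \<Longrightarrow>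
      (AE x in M. incseq (\<lambda>n. F n x) \<and> (\<lambda>n. F n x) \<longlonglongrightarrow> f x) \<Longrightarrow>
      incseq (\<lambda>n. \<rho> (F n)) \<and> (\<lambda>n. \<rho> (F n)) \<longlonglongrightarrow> \<rho> f"
    and local_integrable: "\<And>E. E \<in> sets M \<Longrightarrow> emeasure M E < \<infinity> \<Longrightarrow>
      \<exists>C::real. 0 < C \<and> (\<forall>f\<in>borel_measurable M. (\<integral>\<^sup>+x\<in>E. f x \<partial>M) \<le> ennreal C * \<rho> f)"

definition fn_norm :: "(('a \<Rightarrow> ennreal) \<Rightarrow> ennreal) \<Rightarrow> ('a \<Rightarrow> real) \<Rightarrow> ennreal" where
  "fn_norm \<rho> f = \<rho> (\<lambda>x. ennreal \<bar>f x\<bar>)"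

definition fn_space :: "'a measure \<Rightarrow> (('a \<Rightarrow> ennreal) \<Rightarrow> ennreal) \<Rightarrow> ('a \<Rightarrow> real) set" where
  "fn_space M \<rho> = {f \<in> borel_measurable M. fn_norm \<rho> f < \<infinity>}"

text \<open>
  A space is given by the set \<open>X\<close> of representatives of its classes and by the norm \<open>nrm\<close> on
  measurable functions, which takes the value \<open>\<infinity>\<close> outside \<open>X\<close>. The classes are those of equality
  almost everywhere: the norm vanishes exactly on the functions that are zero almost everywhere.
\<close>

definition banach_function_space ::
    "'a measure \<Rightarrow> ('a \<Rightarrow> real) set \<Rightarrow> (('a \<Rightarrow> real) \<Rightarrow> ennreal) \<Rightarrow> bool" where
  "banach_function_space M X nrm \<longleftrightarrow>
    (\<exists>\<rho>. function_norm M \<rho> \<and> X = fn_space M \<rho> \<and> (\<forall>f\<in>borel_measurable M. nrm f = fn_norm \<rho> f))"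

definition norm_complete :: "('a \<Rightarrow> real) set \<Rightarrow> (('a \<Rightarrow> real) \<Rightarrow> ennreal) \<Rightarrow> bool" where
  "norm_complete X nrm \<longleftrightarrow>
    (\<forall>f :: nat \<Rightarrow> 'a \<Rightarrow> real.
      (\<forall>n. f n \<in> X) \<and>
      (\<forall>e::real. 0 < e \<longrightarrow> (\<exists>k. \<forall>m\<ge>k. \<forall>n\<ge>k. nrm (\<lambda>x. f m x - f n x) < ennreal e)) \<longrightarrow>
      (\<exists>g\<in>X. (\<lambda>n. nrm (\<lambda>x. f n x - g x)) \<longlonglongrightarrow> 0))"

definition order_continuous ::
    "'a measure \<Rightarrow> ('a \<Rightarrow> real) set \<Rightarrow> (('a \<Rightarrow> real) \<Rightarrow> ennreal) \<Rightarrow> bool" where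
  "order_continuous M X nrm \<longleftrightarrow>
    (\<forall>g :: nat \<Rightarrow> 'a \<Rightarrow> real.
      (\<forall>n. g n \<in> X) \<and> (AE x in M. decseq (\<lambda>n. g n x) \<and> (\<lambda>n. g n x) \<longlonglongrightarrow> 0) \<longrightarrow>
      decseq (\<lambda>n. nrm (g n)) \<and> (\<lambda>n. nrm (g n)) \<longlonglongrightarrow> 0)"

definition equimeasurable :: "'a measure \<Rightarrow> ('a \<Rightarrow> real) \<Rightarrow> ('a \<Rightarrow> real) \<Rightarrow> bool" where
  "equimeasurable M f g \<longleftrightarrow>
    (\<forall>s\<ge>0. emeasure M {x \<in> space M. s < \<bar>f x\<bar>} = emeasure M {x \<in> space M. s < \<bar>g x\<bar>})"

definition rearrangement_invariant ::
    "'a measure \<Rightarrow> ('a \<Rightarrow> real) set \<Rightarrow> (('a \<Rightarrow> real) \<Rightarrow> ennreal) \<Rightarrow> bool" where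
  "rearrangement_invariant M X nrm \<longleftrightarrow>
    (\<forall>f\<in>X. \<forall>g\<in>borel_measurable M. equimeasurable M f g \<longrightarrow> g \<in> X \<and> nrm g = nrm f)"

definition fatou_property :: "'a measure \<Rightarrow> (('a \<Rightarrow> real) \<Rightarrow> ennreal) \<Rightarrow> bool" where
  "fatou_property M nrm \<longleftrightarrow>
    (\<forall>(f :: nat \<Rightarrow> 'a \<Rightarrow> real) g.
      (\<forall>n. f n \<in> borel_measurable M) \<and> g \<in> borel_measurable M \<and>
      (AE x in M. (\<forall>n. 0 \<le> f n x) \<and> incseq (\<lambda>n. f n x) \<and> (\<lambda>n. f n x) \<longlonglongrightarrow> g x) \<longrightarrow>
      incseq (\<lambda>n. nrm (f n)) \<and> (\<lambda>n. nrm (f n)) \<longlonglongrightarrow> nrm g)"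

text \<open>Power with a positive real exponent, with \<open>\<infinity>\<close> mapped to \<open>\<infinity>\<close>.\<close>

definition ennreal_power :: "ennreal \<Rightarrow> real \<Rightarrow> ennreal" where
  "ennreal_power x r = (if x = \<infinity> then \<infinity> else ennreal (enn2real x powr r))"

definition Lp_norm :: "'a measure \<Rightarrow> ('a \<Rightarrow> real) \<Rightarrow> real \<Rightarrow> ennreal" where
  "Lp_norm M f p = ennreal_power (\<integral>\<^sup>+x. ennreal (\<bar>f x\<bar> powr p) \<partial>M) (1 / p)"

text \<open>
  The function norm \<open>N\<close> is one on the measure space \<open>interval_measure_space a b\<close>, so it does not
  see the values of \<open>Lp_norm M f\<close> outside \<open>(a,b)\<close>.
\<close>

abbreviation interval_measure_space :: "real \<Rightarrow> ereal \<Rightarrow> real measure" where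
  "interval_measure_space a b \<equiv> lebesgue_on (einterval (ereal a) b)"

definition CGLS_norm ::
    "'a measure \<Rightarrow> ((real \<Rightarrow> ennreal) \<Rightarrow> ennreal) \<Rightarrow> ('a \<Rightarrow> real) \<Rightarrow> ennreal" where
  "CGLS_norm M N f = N (Lp_norm M f)"

definition CGLS ::
    "'a measure \<Rightarrow> ((real \<Rightarrow> ennreal) \<Rightarrow> ennreal) \<Rightarrow> ('a \<Rightarrow> real) set" where
  "CGLS M N = {f \<in> borel_measurable M. CGLS_norm M N f < \<infinity>}"

end

theory Submission
  imports Defs
begin

text \<open>
  The proof extends \<open>f \<mapsto> \<langle>|f|\<^sub>p\<rangle>\<close> to functions with values in \<open>[0,\<infinity>]\<close> and shows that the extension
  \<open>\<rho> f = N (ennreal_Lp_norm M f)\<close> is again a function norm (\<open>function_norm_composed\<close>). Each axiom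
  holds for \<open>|f|\<^sub>p\<close> at every single exponent \<open>p \<in> (a,b)\<close>, by Minkowski's inequality for the triangle
  inequality and by monotone convergence for the Fatou property, and the monotonicity and the same
  axiom of \<open>N\<close> transport it to \<open>\<rho>\<close>. Only local integrability mixes the exponents: the estimate of
  \<open>\<integral>\<^sub>E f\<close> by \<open>(1 + \<mu> E) |f|\<^sub>p\<close> has a constant free of \<open>p\<close>, and integrating it over a bounded interval
  of exponents leads to the local integrability of \<open>N\<close>.

  Completeness holds for every function norm by the Riesz-Fischer argument
  (\<open>norm_complete_fn_space\<close>), where the Fatou property replaces the convergence theorems.

  Order continuity is passed on by \<open>N\<close>: if \<open>g\<^sub>n\<close> decreases to \<open>0\<close> almost everywhere and
  \<open>|g\<^sub>0|\<^sub>p < \<infinity>\<close>, then \<open>|g\<^sub>n|\<^sub>p\<close> decreases to \<open>0\<close> by dominated convergence. A function of finite norm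
  is finite almost everywhere (\<open>finite_norm_imp_AE_finite\<close>), so this covers almost every \<open>p\<close>.

  Rearrangement invariance is a property of the single norms \<open>|f|\<^sub>p\<close>: the layer cake formula
  expresses them by the measures of the sets \<open>{|f| > s}\<close>.
\<close>

section \<open>Powers of extended nonnegative reals\<close>

lemma ennreal_power_top [simp]: "ennreal_power top r = top"
  by (simp add: ennreal_power_def)

lemma ennreal_power_zero [simp]: "ennreal_power 0 r = 0"
  by (simp add: ennreal_power_def)

lemma ennreal_power_ennreal: "0 \<le> x \<Longrightarrow> ennreal_power (ennreal x) r = ennreal (x powr r)"
  by (simp add: ennreal_power_def)

lemma ennreal_power_eq_top_iff [simp]: "ennreal_power x r = top \<longleftrightarrow> x = top"
  by (simp add: ennreal_power_def)

lemma ennreal_power_eq_zero_iff [simp]: "ennreal_power x r = 0 \<longleftrightarrow> x = 0"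
  by (cases x) (auto simp: ennreal_power_def)

lemma ennreal_power_mono:
  assumes "x \<le> y" "0 \<le> r"
  shows "ennreal_power x r \<le> ennreal_power y r"
proof (cases y)
  case (real v)
  then obtain u where "x = ennreal u" "0 \<le> u" "u \<le> v"
    using assms(1) by (cases x) (auto simp: top_unique)
  then show ?thesis using real assms(2)
    by (simp add: ennreal_power_ennreal ennreal_leI powr_mono2)
qed (simp add: ennreal_power_def)

lemma ennreal_power_inverse:
  assumes "r \<noteq> 0"
  shows "ennreal_power (ennreal_power x r) (1 / r) = x"
    and "ennreal_power (ennreal_power x (1 / r)) r = x"
  using assms by (cases x; simp add: ennreal_power_def powr_powr)+

lemma ennreal_power_mult:
  "0 \<le> c \<Longrightarrow> ennreal_power (ennreal c * x) r = ennreal (c powr r) * ennreal_power x r"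
proof (cases x)
  case (real u)
  assume "0 \<le> c"
  then show ?thesis using real
    by (simp add: ennreal_power_ennreal powr_mult flip: ennreal_mult)
next
  case top
  assume "0 \<le> c"
  then show ?thesis using top by (cases "c = 0") (auto simp: ennreal_power_def ennreal_mult_top)
qed

text \<open>A monotone map with a monotone inverse preserves suprema.\<close>

lemma ennreal_power_SUP:
  assumes "0 < r" "I \<noteq> {}"
  shows "ennreal_power (SUP i\<in>I. F i) r = (SUP i\<in>I. ennreal_power (F i) r)"
proof (rule antisym)
  have "(SUP i\<in>I. F i) \<le> ennreal_power (SUP i\<in>I. ennreal_power (F i) r) (1 / r)"
  proof (rule SUP_least)
    fix i assume "i \<in> I"
    then have "ennreal_power (F i) r \<le> (SUP i\<in>I. ennreal_power (F i) r)"
      by (rule SUP_upper)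
    then have "ennreal_power (ennreal_power (F i) r) (1 / r)
        \<le> ennreal_power (SUP i\<in>I. ennreal_power (F i) r) (1 / r)"
      using assms(1) by (intro ennreal_power_mono) auto
    then show "F i \<le> ennreal_power (SUP i\<in>I. ennreal_power (F i) r) (1 / r)"
      using assms(1) by (simp add: ennreal_power_inverse)
  qed
  then have "ennreal_power (SUP i\<in>I. F i) r
      \<le> ennreal_power (ennreal_power (SUP i\<in>I. ennreal_power (F i) r) (1 / r)) r"
    using assms(1) by (intro ennreal_power_mono) auto
  then show "ennreal_power (SUP i\<in>I. F i) r \<le> (SUP i\<in>I. ennreal_power (F i) r)"
    using assms(1) by (simp add: ennreal_power_inverse)
next
  show "(SUP i\<in>I. ennreal_power (F i) r) \<le> ennreal_power (SUP i\<in>I. F i) r"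
    using assms by (intro SUP_least ennreal_power_mono SUP_upper) auto
qed

lemma borel_measurable_ennreal_power [measurable (raw)]:
  assumes [measurable]: "f \<in> borel_measurable M" "g \<in> borel_measurable M"
  shows "(\<lambda>x. ennreal_power (f x) (g x)) \<in> borel_measurable M"
  unfolding ennreal_power_def by measurable

text \<open>
  Convexity of \<open>t \<mapsto> t powr p\<close>, applied to \<open>u / A\<close> and \<open>v / B\<close> with the weights \<open>A / (A + B)\<close>
  and \<open>B / (A + B)\<close>.
\<close>

lemma powr_add_le_weighted:
  fixes u v A B p :: real
  assumes "1 \<le> p" "0 < A" "0 < B" "0 \<le> u" "0 \<le> v"
  shows "(u + v) powr p \<le> (A + B) powr (p - 1) * (A powr (1 - p) * u powr p + B powr (1 - p) * v powr p)"
proof -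
  have convex: "(l * x + (1 - l) * y) powr p \<le> l * x powr p + (1 - l) * y powr p"
    if lxy: "0 < l" "l < 1" "0 \<le> x" "0 \<le> y" for l x y :: real
  proof -
    have power_le: "l powr p \<le> l" if "0 < l" "l < 1" for l :: real
      using that assms(1) powr_mono'[of 1 p l] by simp
    consider "x = 0" | "y = 0" | "0 < x" "0 < y" using lxy by linarith
    then show ?thesis
    proof cases
      case 1
      then show ?thesis using lxy power_le[of "1 - l"]
        by (simp add: powr_mult mult_right_mono)
    next
      case 2
      then show ?thesis using lxy power_le[of l]
        by (simp add: powr_mult mult_right_mono)
    next
      case 3
      then show ?thesis
        using convex_onD[OF powr_convex[OF assms(1)], of "1 - l" x y] lxy by simp
    qed
  qed
  define S where "S = A + B"
  have S: "0 < S" "1 - A / S = B / S" "A / S < 1" "0 < A / S"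
    using assms by (auto simp: S_def field_simps)
  have split: "c powr (1 - p) * w powr p = c * (w / c) powr p" if "0 < c" "0 \<le> w" for c w
    using that by (simp add: powr_diff powr_divide)
  have "(u + v) powr p = (S * (A / S * (u / A) + B / S * (v / B))) powr p"
    using assms S(1) by (simp flip: add_divide_distrib distrib_left)
  also have "\<dots> = S powr p * (A / S * (u / A) + B / S * (v / B)) powr p"
    by (rule powr_mult)
  also have "\<dots> \<le> S powr p * (A / S * (u / A) powr p + B / S * (v / B) powr p)"
    using convex[of "A / S" "u / A" "v / B"] S assms by (intro mult_left_mono) auto
  also have "\<dots> = S powr (p - 1) * (A * (u / A) powr p + B * (v / B) powr p)"
    using S(1) by (simp add: powr_diff field_simps)
  finally show ?thesis
    using assms by (simp add: split S_def)
qed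

lemma ennreal_power_add_le_weighted:
  assumes "1 \<le> p" "0 < A" "0 < B"
  shows "ennreal_power (x + y) p \<le> ennreal ((A + B) powr (p - 1)) *
    (ennreal (A powr (1 - p)) * ennreal_power x p + ennreal (B powr (1 - p)) * ennreal_power y p)"
proof (cases "x = \<infinity> \<or> y = \<infinity>")
  case True
  then show ?thesis using assms by (auto simp: ennreal_mult_top)
next
  case False
  then obtain u v where "x = ennreal u" "0 \<le> u" "y = ennreal v" "0 \<le> v"
    by (cases x; cases y) auto
  then show ?thesis
    using powr_add_le_weighted[OF assms, of u v]
    by (simp add: ennreal_power_ennreal ennreal_leI flip: ennreal_mult ennreal_plus)
qed

section \<open>Function norms\<close>

lemma (in function_norm) norm_cong_AE:
  assumes "f \<in> borel_measurable M" "g \<in> borel_measurable M" "AE x in M. f x = g x"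
  shows "\<rho> f = \<rho> g"
  using assms by (intro antisym mono) auto

text \<open>
  The function \<open>u\<close> that is \<open>\<infinity>\<close> where \<open>f\<close> is and \<open>0\<close> elsewhere satisfies \<open>u = 2 u\<close>, and its norm
  is finite, so that the norm has to vanish.
\<close>

lemma (in function_norm) finite_norm_imp_AE_finite:
  assumes [measurable]: "f \<in> borel_measurable M" and "\<rho> f < \<infinity>"
  shows "AE x in M. f x < \<infinity>"
proof -
  define u where "u x = (if f x = \<infinity> then \<infinity> else 0 :: ennreal)" for x
  have u [measurable]: "u \<in> borel_measurable M" unfolding u_def by measurable
  have "\<rho> u \<le> \<rho> f" by (intro mono) (auto simp: u_def)
  then have fin: "\<rho> u < \<infinity>" using assms(2) by simp
  have "\<rho> u = \<rho> (\<lambda>x. ennreal 2 * u x)"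
    by (intro arg_cong[where f = \<rho>]) (auto simp: u_def ennreal_mult_top)
  also have "\<dots> = ennreal 2 * \<rho> u" by (intro scale) auto
  finally have "\<rho> u = 0" using fin
    by (cases "\<rho> u") (auto simp flip: ennreal_mult ennreal_numeral)
  then have "AE x in M. u x = 0" using zero_iff u by auto
  then show ?thesis by eventually_elim (auto simp: u_def less_top split: if_splits)
qed

text \<open>Fatou's lemma, obtained from the monotone sequence of the functions \<open>inf {F m | m \<ge> n}\<close>.\<close>

lemma (in function_norm) norm_limit_le:
  assumes [measurable]: "\<And>n. F n \<in> borel_measurable M" "f \<in> borel_measurable M"
    and lim: "AE x in M. (\<lambda>n. F n x) \<longlonglongrightarrow> f x" and le: "\<And>n. \<rho> (F n) \<le> c"
  shows "\<rho> f \<le> c"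
proof -
  define G where "G n x = (INF m\<in>{n..}. F m x)" for n x
  have G [measurable]: "G n \<in> borel_measurable M" for n unfolding G_def by measurable
  have "AE x in M. incseq (\<lambda>n. G n x) \<and> (\<lambda>n. G n x) \<longlonglongrightarrow> f x"
    using lim
  proof eventually_elim
    fix x assume "(\<lambda>n. F n x) \<longlonglongrightarrow> f x"
    then have "liminf (\<lambda>n. F n x) = f x" by (intro lim_imp_Liminf) auto
    then have "(SUP n. G n x) = f x" by (simp add: liminf_SUP_INF G_def)
    moreover have "incseq (\<lambda>n. G n x)" unfolding G_def
      by (intro monoI INF_superset_mono) auto
    ultimately show "incseq (\<lambda>n. G n x) \<and> (\<lambda>n. G n x) \<longlonglongrightarrow> f x"
      using LIMSEQ_SUP[of "\<lambda>n. G n x"] by simp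
  qed
  then have "(\<lambda>n. \<rho> (G n)) \<longlonglongrightarrow> \<rho> f" using fatou[of G f] by auto
  moreover have "\<rho> (G n) \<le> c" for n
  proof -
    have "\<rho> (G n) \<le> \<rho> (F n)" by (intro mono AE_I2) (auto simp: G_def intro: INF_lower)
    then show ?thesis using le order_trans by blast
  qed
  ultimately show ?thesis by (intro LIMSEQ_le_const2) auto
qed

lemma (in function_norm) norm_sum_le:
  assumes [measurable]: "\<And>i. F i \<in> borel_measurable M"
  shows "\<rho> (\<lambda>x. \<Sum>i<n. F i x) \<le> (\<Sum>i<(n::nat). \<rho> (F i))"
proof (induction n)
  case 0
  then show ?case using zero_iff[of "\<lambda>x. 0"] by simp
next
  case (Suc n)
  have "\<rho> (\<lambda>x. \<Sum>i<Suc n. F i x) \<le> \<rho> (\<lambda>x. \<Sum>i<n. F i x) + \<rho> (F n)"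
    using triangle[of "\<lambda>x. \<Sum>i<n. F i x" "F n"] by simp
  also have "\<dots> \<le> (\<Sum>i<Suc n. \<rho> (F i))" using Suc by (simp add: add_right_mono)
  finally show ?case .
qed

text \<open>
  The Riesz-Fischer argument: along a subsequence whose successive differences have norm below
  \<open>2\<^sup>-\<^sup>i\<close> the sum of their absolute values has finite norm, hence is finite almost everywhere, and the
  subsequence converges almost everywhere. Fatou's lemma then turns the Cauchy estimate into one
  for the distance to the limit.
\<close>

lemma (in function_norm) norm_complete_fn_space: "norm_complete (fn_space M \<rho>) (fn_norm \<rho>)"
  unfolding norm_complete_def
proof (intro allI impI, elim conjE)
  fix f :: "nat \<Rightarrow> 'a \<Rightarrow> real"
  assume X: "\<forall>n. f n \<in> fn_space M \<rho>"
  assume "\<forall>e::real. 0 < e \<longrightarrow>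
    (\<exists>k. \<forall>m\<ge>k. \<forall>n\<ge>k. fn_norm \<rho> (\<lambda>x. f m x - f n x) < ennreal e)"
  then have "\<forall>e. \<exists>k. 0 < e \<longrightarrow> (\<forall>m\<ge>k. \<forall>n\<ge>k. fn_norm \<rho> (\<lambda>x. f m x - f n x) < ennreal e)"
    by blast
  then obtain K where K: "\<And>e m n. \<lbrakk>0 < e; K e \<le> m; K e \<le> n\<rbrakk>
      \<Longrightarrow> fn_norm \<rho> (\<lambda>x. f m x - f n x) < ennreal e"
    by metis
  have f [measurable]: "f n \<in> borel_measurable M" and fin: "fn_norm \<rho> (f n) < \<infinity>" for n
    using X by (auto simp: fn_space_def)
  (* The partial maxima make the chosen indices increase; adding n makes them unbounded. *)
  define s where "s n = n + Max ((\<lambda>i. K ((1/2) ^ i)) ` {..n})" for n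
  have s_K: "K ((1/2) ^ n) \<le> s n" for n
    unfolding s_def by (intro trans_le_add2 Max_ge) auto
  have s_mono: "s n \<le> s (Suc n)" for n
    unfolding s_def by (intro add_mono Max_mono) auto
  have s_ge: "n \<le> s n" for n by (simp add: s_def)
  define d where "d i x = ennreal \<bar>f (s (Suc i)) x - f (s i) x\<bar>" for i x
  have d [measurable]: "d i \<in> borel_measurable M" for i unfolding d_def by measurable
  have d_le: "\<rho> (d i) \<le> ennreal ((1/2) ^ i)" for i
    using K[of "(1/2) ^ i" "s (Suc i)" "s i"] s_K[of i] s_mono[of i]
    unfolding fn_norm_def d_def by auto
  have "\<rho> (\<lambda>x. \<Sum>i. d i x) \<le> ennreal 2"
  proof (rule norm_limit_le[of "\<lambda>n x. \<Sum>i<n. d i x"])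
    fix n
    have "\<rho> (\<lambda>x. \<Sum>i<n. d i x) \<le> (\<Sum>i<n. \<rho> (d i))" by (intro norm_sum_le) simp
    also have "\<dots> \<le> (\<Sum>i<n. ennreal ((1/2) ^ i))" by (intro sum_mono d_le)
    also have "\<dots> = ennreal (\<Sum>i<n. (1/2) ^ i)" by (intro sum_ennreal) simp
    also have "\<dots> \<le> ennreal 2"
      using sum_le_suminf[of "\<lambda>i. (1/2::real) ^ i" "{..<n}"] 
      by (intro ennreal_leI) (simp add: suminf_geometric)
    finally show "\<rho> (\<lambda>x. \<Sum>i<n. d i x) \<le> ennreal 2" .
  next
    show "AE x in M. (\<lambda>n. \<Sum>i<n. d i x) \<longlonglongrightarrow> (\<Sum>i. d i x)"
      by (intro AE_I2 summable_LIMSEQ) simp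
  qed auto
  then have "\<rho> (\<lambda>x. \<Sum>i. d i x) < \<infinity>" using order_le_less_trans by fastforce
  then have "AE x in M. (\<Sum>i. d i x) < \<infinity>"
    by (intro finite_norm_imp_AE_finite) auto
  then have conv: "AE x in M. (\<lambda>i. f (s i) x) \<longlonglongrightarrow> lim (\<lambda>i. f (s i) x)"
  proof eventually_elim
    fix x assume "(\<Sum>i. d i x) < \<infinity>"
    then have "summable (\<lambda>i. \<bar>f (s (Suc i)) x - f (s i) x\<bar>)"
      unfolding d_def by (intro summable_suminf_not_top) auto
    then have "summable (\<lambda>i. f (s (Suc i)) x - f (s i) x)"
      by (rule summable_rabs_cancel)
    then have "convergent (\<lambda>n. \<Sum>i<n. f (s (Suc i)) x - f (s i) x)"
      by (simp add: summable_iff_convergent)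
    then have "convergent (\<lambda>n. f (s n) x - f (s 0) x)"
      using sum_lessThan_telescope[of "\<lambda>i. f (s i) x"] by simp
    then have "convergent (\<lambda>n. (f (s n) x - f (s 0) x) + f (s 0) x)"
      by (intro convergent_add convergent_const)
    then show "(\<lambda>i. f (s i) x) \<longlonglongrightarrow> lim (\<lambda>i. f (s i) x)"
      by (simp add: convergent_LIMSEQ_iff)
  qed
  define g where "g x = lim (\<lambda>i. f (s i) x)" for x
  have g [measurable]: "g \<in> borel_measurable M" unfolding g_def by measurable
  have near: "fn_norm \<rho> (\<lambda>x. f n x - g x) \<le> ennreal e" if "0 < e" "K e \<le> n" for e n
    unfolding fn_norm_def
  proof (rule norm_limit_le[of "\<lambda>j x. ennreal \<bar>f n x - f (s (j + K e)) x\<bar>"])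
    show "AE x in M. (\<lambda>j. ennreal \<bar>f n x - f (s (j + K e)) x\<bar>) \<longlonglongrightarrow> ennreal \<bar>f n x - g x\<bar>"
      using conv
    proof eventually_elim
      fix x assume "(\<lambda>i. f (s i) x) \<longlonglongrightarrow> lim (\<lambda>i. f (s i) x)"
      then have "(\<lambda>j. f (s (j + K e)) x) \<longlonglongrightarrow> g x"
        unfolding g_def by (rule LIMSEQ_ignore_initial_segment)
      then show "(\<lambda>j. ennreal \<bar>f n x - f (s (j + K e)) x\<bar>) \<longlonglongrightarrow> ennreal \<bar>f n x - g x\<bar>"
        by (intro tendsto_intros)
    qed
    show "\<rho> (\<lambda>x. ennreal \<bar>f n x - f (s (j + K e)) x\<bar>) \<le> ennreal e" for j
      using K[OF that, of "s (j + K e)"] s_ge[of "j + K e"] unfolding fn_norm_def by auto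
  qed auto
  have "fn_norm \<rho> g \<le> fn_norm \<rho> (f (K 1)) + fn_norm \<rho> (\<lambda>x. f (K 1) x - g x)"
  proof -
    have "fn_norm \<rho> g \<le> \<rho> (\<lambda>x. ennreal \<bar>f (K 1) x\<bar> + ennreal \<bar>f (K 1) x - g x\<bar>)"
      unfolding fn_norm_def
      by (intro mono AE_I2) (auto intro!: ennreal_leI simp flip: ennreal_plus)
    also have "\<dots> \<le> fn_norm \<rho> (f (K 1)) + fn_norm \<rho> (\<lambda>x. f (K 1) x - g x)"
      unfolding fn_norm_def by (intro triangle) auto
    finally show ?thesis .
  qed
  also have "\<dots> < \<infinity>"
  proof -
    have "fn_norm \<rho> (\<lambda>x. f (K 1) x - g x) < \<infinity>"
      using near[of 1 "K 1"] order_le_less_trans by fastforce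
    then show ?thesis using fin[of "K 1"] by simp
  qed
  finally have "g \<in> fn_space M \<rho>" by (simp add: fn_space_def)
  moreover have "(\<lambda>n. fn_norm \<rho> (\<lambda>x. f n x - g x)) \<longlonglongrightarrow> 0"
  proof (rule order_tendstoI)
    fix y :: ennreal assume "0 < y"
    then obtain e where e: "0 < e" "ennreal e < y"
      using dense[of 0 y] by (metis ennreal_less_zero_iff less_top top.not_eq_extremum
          ennreal_enn2real order_less_trans)
    then have "\<forall>n\<ge>K e. fn_norm \<rho> (\<lambda>x. f n x - g x) < y"
      using near order_le_less_trans by blast
    then show "\<forall>\<^sub>F n in sequentially. fn_norm \<rho> (\<lambda>x. f n x - g x) < y"
      using eventually_sequentially by auto
  qed simp
  ultimately show "\<exists>g\<in>fn_space M \<rho>. (\<lambda>n. fn_norm \<rho> (\<lambda>x. f n x - g x)) \<longlonglongrightarrow> 0"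
    by blast
qed

lemma (in function_norm) fatou_property_fn_norm: "fatou_property M (fn_norm \<rho>)"
  unfolding fatou_property_def fn_norm_def
proof (intro allI impI, elim conjE)
  fix f :: "nat \<Rightarrow> 'a \<Rightarrow> real" and g
  assume f: "\<forall>n. f n \<in> borel_measurable M" and [measurable]: "g \<in> borel_measurable M"
    and lim: "AE x in M. (\<forall>n. 0 \<le> f n x) \<and> incseq (\<lambda>n. f n x) \<and> (\<lambda>n. f n x) \<longlonglongrightarrow> g x"
  have [measurable]: "f n \<in> borel_measurable M" for n using f by blast
  show "incseq (\<lambda>n. \<rho> (\<lambda>x. ennreal \<bar>f n x\<bar>))
      \<and> (\<lambda>n. \<rho> (\<lambda>x. ennreal \<bar>f n x\<bar>)) \<longlonglongrightarrow> \<rho> (\<lambda>x. ennreal \<bar>g x\<bar>)"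
  proof (rule fatou)
    show "AE x in M. incseq (\<lambda>n. ennreal \<bar>f n x\<bar>)
        \<and> (\<lambda>n. ennreal \<bar>f n x\<bar>) \<longlonglongrightarrow> ennreal \<bar>g x\<bar>"
      using lim
    proof eventually_elim
      fix x assume *: "(\<forall>n. 0 \<le> f n x) \<and> incseq (\<lambda>n. f n x) \<and> (\<lambda>n. f n x) \<longlonglongrightarrow> g x"
      then have "incseq (\<lambda>n. ennreal \<bar>f n x\<bar>)" by (auto simp: incseq_def intro: ennreal_leI)
      moreover have "(\<lambda>n. ennreal \<bar>f n x\<bar>) \<longlonglongrightarrow> ennreal \<bar>g x\<bar>"
        using * by (intro tendsto_intros) blast
      ultimately show "incseq (\<lambda>n. ennreal \<bar>f n x\<bar>)
          \<and> (\<lambda>n. ennreal \<bar>f n x\<bar>) \<longlonglongrightarrow> ennreal \<bar>g x\<bar>" ..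
    qed
  qed auto
qed

section \<open>The Lebesgue norms of a function with values in \<open>[0,\<infinity>]\<close>\<close>

definition ennreal_Lp_norm :: "'a measure \<Rightarrow> ('a \<Rightarrow> ennreal) \<Rightarrow> real \<Rightarrow> ennreal" where
  "ennreal_Lp_norm M f p = ennreal_power (\<integral>\<^sup>+x. ennreal_power (f x) p \<partial>M) (1 / p)"

lemma Lp_norm_eq_ennreal_Lp_norm: "Lp_norm M f = ennreal_Lp_norm M (\<lambda>x. ennreal \<bar>f x\<bar>)"
  by (simp add: fun_eq_iff Lp_norm_def ennreal_Lp_norm_def ennreal_power_ennreal)

lemma borel_measurable_ennreal_Lp_norm:
  assumes "sigma_finite_measure M" and [measurable]: "f \<in> borel_measurable M"
  shows "ennreal_Lp_norm M f \<in> borel_measurable (lebesgue_on S)"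
proof -
  interpret sigma_finite_measure M by fact
  have "ennreal_Lp_norm M f \<in> borel_measurable lborel"
    unfolding ennreal_Lp_norm_def by measurable
  then show ?thesis by (intro measurable_restrict_space1 measurable_completion)
qed

lemma ennreal_Lp_norm_eq_zero_iff:
  assumes [measurable]: "f \<in> borel_measurable M"
  shows "ennreal_Lp_norm M f p = 0 \<longleftrightarrow> (AE x in M. f x = 0)"
  by (simp add: ennreal_Lp_norm_def nn_integral_0_iff_AE)

lemma ennreal_Lp_norm_scale:
  assumes [measurable]: "f \<in> borel_measurable M" and "0 \<le> c" "0 < p"
  shows "ennreal_Lp_norm M (\<lambda>x. ennreal c * f x) p = ennreal c * ennreal_Lp_norm M f p"
  using assms(2,3)
  by (simp add: ennreal_Lp_norm_def ennreal_power_mult nn_integral_cmult powr_powr)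

lemma ennreal_Lp_norm_mono:
  assumes "AE x in M. f x \<le> g x" "0 < p"
  shows "ennreal_Lp_norm M f p \<le> ennreal_Lp_norm M g p"
  unfolding ennreal_Lp_norm_def
  using assms by (intro ennreal_power_mono nn_integral_mono_AE)
    (auto elim!: eventually_mono intro!: ennreal_power_mono)

lemma ennreal_Lp_norm_le_iff:
  assumes "0 < p" "0 \<le> A"
  shows "ennreal_Lp_norm M f p \<le> ennreal A \<longleftrightarrow> (\<integral>\<^sup>+x. ennreal_power (f x) p \<partial>M) \<le> ennreal (A powr p)"
proof
  assume "ennreal_Lp_norm M f p \<le> ennreal A"
  then have "ennreal_power (ennreal_Lp_norm M f p) p \<le> ennreal_power (ennreal A) p"
    using assms by (intro ennreal_power_mono) auto
  then show "(\<integral>\<^sup>+x. ennreal_power (f x) p \<partial>M) \<le> ennreal (A powr p)"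
    using assms by (simp add: ennreal_Lp_norm_def ennreal_power_inverse ennreal_power_ennreal)
next
  assume "(\<integral>\<^sup>+x. ennreal_power (f x) p \<partial>M) \<le> ennreal (A powr p)"
  then have "ennreal_Lp_norm M f p \<le> ennreal_power (ennreal (A powr p)) (1 / p)"
    unfolding ennreal_Lp_norm_def using assms by (intro ennreal_power_mono) auto
  then show "ennreal_Lp_norm M f p \<le> ennreal A"
    using assms by (simp add: ennreal_power_ennreal powr_powr)
qed

text \<open>
  Minkowski's inequality. For \<open>A\<close> and \<open>B\<close> slightly above the two norms, integrating the weighted
  convexity estimate bounds the integral of the power of the sum by
  \<open>(A + B) powr (p - 1) * (A + B)\<close>.
\<close>

lemma ennreal_Lp_norm_triangle:
  assumes [measurable]: "f \<in> borel_measurable M" "g \<in> borel_measurable M" and p: "1 \<le> p"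
  shows "ennreal_Lp_norm M (\<lambda>x. f x + g x) p \<le> ennreal_Lp_norm M f p + ennreal_Lp_norm M g p"
proof (rule ennreal_le_epsilon)
  fix e :: real
  assume e: "0 < e" and fin: "ennreal_Lp_norm M f p + ennreal_Lp_norm M g p < top"
  define A where "A = enn2real (ennreal_Lp_norm M f p) + e / 2"
  define B where "B = enn2real (ennreal_Lp_norm M g p) + e / 2"
  have AB: "0 < A" "0 < B" using e by (simp_all add: A_def B_def add_nonneg_pos)
  have le: "ennreal_Lp_norm M f p \<le> ennreal A" "ennreal_Lp_norm M g p \<le> ennreal B"
    using fin e by (simp_all add: A_def B_def)
  have "(\<integral>\<^sup>+x. ennreal_power (f x + g x) p \<partial>M)
      \<le> (\<integral>\<^sup>+x. ennreal ((A + B) powr (p - 1)) * (ennreal (A powr (1 - p)) * ennreal_power (f x) p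
            + ennreal (B powr (1 - p)) * ennreal_power (g x) p) \<partial>M)"
    by (intro nn_integral_mono ennreal_power_add_le_weighted p AB)
  also have "\<dots> = ennreal ((A + B) powr (p - 1)) *
      (ennreal (A powr (1 - p)) * (\<integral>\<^sup>+x. ennreal_power (f x) p \<partial>M)
        + ennreal (B powr (1 - p)) * (\<integral>\<^sup>+x. ennreal_power (g x) p \<partial>M))"
    by (simp add: nn_integral_cmult nn_integral_add)
  also have "\<dots> \<le> ennreal ((A + B) powr (p - 1)) *
      (ennreal (A powr (1 - p)) * ennreal (A powr p) + ennreal (B powr (1 - p)) * ennreal (B powr p))"
    using le AB p by (intro mult_left_mono add_mono) (auto simp: ennreal_Lp_norm_le_iff)
  also have "\<dots> = ennreal ((A + B) powr (p - 1) * (A powr (1 - p) * A powr p + B powr (1 - p) * B powr p))"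
    by (simp flip: ennreal_mult ennreal_plus)
  also have "(A + B) powr (p - 1) * (A powr (1 - p) * A powr p + B powr (1 - p) * B powr p)
      = (A + B) powr p"
    using AB by (simp add: powr_diff)
  finally have "ennreal_Lp_norm M (\<lambda>x. f x + g x) p \<le> ennreal (A + B)"
    using AB p by (simp add: ennreal_Lp_norm_le_iff del: ennreal_plus)
  also have "ennreal (A + B) = ennreal_Lp_norm M f p + ennreal_Lp_norm M g p + ennreal e"
  proof -
    have "A + B = enn2real (ennreal_Lp_norm M f p) + enn2real (ennreal_Lp_norm M g p) + e"
      by (simp add: A_def B_def)
    then show ?thesis using fin e by (simp add: ennreal_plus)
  qed
  finally show "ennreal_Lp_norm M (\<lambda>x. f x + g x) p
      \<le> ennreal_Lp_norm M f p + ennreal_Lp_norm M g p + ennreal e" .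
qed

lemma ennreal_Lp_norm_monotone_convergence:
  assumes [measurable]: "\<And>n. F n \<in> borel_measurable M" and p: "0 < p"
    and lim: "AE x in M. incseq (\<lambda>n. F n x) \<and> (\<lambda>n. F n x) \<longlonglongrightarrow> f x"
  shows "incseq (\<lambda>n. ennreal_Lp_norm M (F n) p)"
    and "(\<lambda>n. ennreal_Lp_norm M (F n) p) \<longlonglongrightarrow> ennreal_Lp_norm M f p"
proof -
  show inc: "incseq (\<lambda>n. ennreal_Lp_norm M (F n) p)"
  proof (rule monoI)
    fix m n :: nat assume "m \<le> n"
    with lim have "AE x in M. F m x \<le> F n x"
      by (auto elim!: eventually_mono simp: incseq_def)
    then show "ennreal_Lp_norm M (F m) p \<le> ennreal_Lp_norm M (F n) p"
      using p by (rule ennreal_Lp_norm_mono)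
  qed
  have "(\<integral>\<^sup>+x. ennreal_power (f x) p \<partial>M) = (\<integral>\<^sup>+x. (SUP n. ennreal_power (F n x) p) \<partial>M)"
  proof (rule nn_integral_cong_AE)
    show "AE x in M. ennreal_power (f x) p = (SUP n. ennreal_power (F n x) p)"
      using lim
    proof eventually_elim
      fix x assume "incseq (\<lambda>n. F n x) \<and> (\<lambda>n. F n x) \<longlonglongrightarrow> f x"
      then have "f x = (SUP n. F n x)" by (metis LIMSEQ_SUP LIMSEQ_unique)
      then show "ennreal_power (f x) p = (SUP n. ennreal_power (F n x) p)"
        using p by (simp add: ennreal_power_SUP)
    qed
  qed
  also have "\<dots> = (SUP n. \<integral>\<^sup>+x. ennreal_power (F n x) p \<partial>M)"
  proof (rule nn_integral_monotone_convergence_SUP_AE)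
    show "AE x in M. ennreal_power (F n x) p \<le> ennreal_power (F (Suc n) x) p" for n
      using lim p by (auto elim!: eventually_mono intro!: ennreal_power_mono dest: incseq_SucD)
  qed auto
  finally have "ennreal_Lp_norm M f p = (SUP n. ennreal_Lp_norm M (F n) p)"
    using p by (simp add: ennreal_Lp_norm_def ennreal_power_SUP)
  then show "(\<lambda>n. ennreal_Lp_norm M (F n) p) \<longlonglongrightarrow> ennreal_Lp_norm M f p"
    using LIMSEQ_SUP[OF inc] by simp
qed

text \<open>
  If \<open>A\<close> is the norm of \<open>f\<close>, positive and finite, then \<open>f / A \<le> (f / A)\<^sup>p + 1\<close> holds pointwise, and
  the right-hand side has integral at most \<open>1 + \<mu> E\<close> over \<open>E\<close>. The resulting constant is worse than that of Hoelder's
  inequality, but does not depend on \<open>p\<close>.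
\<close>

lemma set_nn_integral_le_ennreal_Lp_norm:
  assumes [measurable]: "f \<in> borel_measurable M" "E \<in> sets M" and p: "1 \<le> p"
  shows "(\<integral>\<^sup>+x\<in>E. f x \<partial>M) \<le> (1 + emeasure M E) * ennreal_Lp_norm M f p"
proof (cases "ennreal_Lp_norm M f p = \<infinity>")
  case True
  then show ?thesis by (simp add: ennreal_mult_top)
next
  case False
  have bound: "(\<integral>\<^sup>+x\<in>E. f x \<partial>M) \<le> (1 + emeasure M E) * ennreal A"
    if A: "0 < A" and le: "ennreal_Lp_norm M f p \<le> ennreal A" for A
  proof -
    have pointwise: "y \<le> ennreal A * (ennreal (A powr (-p)) * ennreal_power y p + 1)" for y
    proof (cases y)
      case (real u)
      have "u / A \<le> (u / A) powr p + 1"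
      proof (cases "1 \<le> u / A")
        case True
        then show ?thesis using powr_mono[OF p, of "u / A"] A real by simp
      next
        case False
        then show ?thesis using powr_ge_zero[of "u / A" p] by linarith
      qed
      then have "u \<le> A * (A powr (-p) * u powr p + 1)"
        using A real by (simp add: powr_divide powr_minus field_simps)
      then show ?thesis using A real
        by (simp add: ennreal_power_ennreal ennreal_leI flip: ennreal_mult ennreal_plus ennreal_1)
    next
      case top
      then show ?thesis using A by (simp add: ennreal_mult_top)
    qed
    have "(\<integral>\<^sup>+x\<in>E. f x \<partial>M)
        \<le> (\<integral>\<^sup>+x. ennreal A * (ennreal (A powr (-p)) * ennreal_power (f x) p + indicator E x) \<partial>M)"
      using pointwise by (intro nn_integral_mono) (auto split: split_indicator)
    also have "\<dots> = ennreal A *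
        (ennreal (A powr (-p)) * (\<integral>\<^sup>+x. ennreal_power (f x) p \<partial>M) + emeasure M E)"
      by (simp add: nn_integral_cmult nn_integral_add)
    also have "\<dots> \<le> ennreal A * (ennreal (A powr (-p)) * ennreal (A powr p) + emeasure M E)"
      using le A p by (intro mult_left_mono add_right_mono) (auto simp: ennreal_Lp_norm_le_iff)
    also have "\<dots> = (1 + emeasure M E) * ennreal A"
      using A by (simp add: mult.commute powr_minus flip: ennreal_mult)
    finally show ?thesis .
  qed
  show ?thesis
  proof (cases "ennreal_Lp_norm M f p = 0")
    case True
    then have "AE x in M. f x = 0" by (simp add: ennreal_Lp_norm_eq_zero_iff)
    then have "(\<integral>\<^sup>+x\<in>E. f x \<partial>M) = 0" by (subst nn_integral_0_iff_AE) auto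
    then show ?thesis by simp
  next
    case pos: False
    then have "0 < enn2real (ennreal_Lp_norm M f p)"
      using False by (simp add: enn2real_positive_iff less_top zero_less_iff_neq_zero)
    then show ?thesis
      using bound[of "enn2real (ennreal_Lp_norm M f p)"] False by (simp add: less_top)
  qed
qed

section \<open>The composed norm is a function norm\<close>

text \<open>
  The axioms are inherited exponent by exponent. Positivity needs that the interval is not a null
  set. Local integrability uses that the bound of the integral over \<open>E\<close> by the Lebesgue norms is
  uniform in the exponent, so that it may be averaged over a bounded subinterval \<open>{a<..<c}\<close>, where
  the local integrability of \<open>N\<close> applies.
\<close>

lemma function_norm_composed:
  fixes a :: real and b :: ereal
  assumes sf: "sigma_finite_measure M" and a: "1 \<le> a" and ab: "ereal a < b"
    and N: "function_norm (interval_measure_space a b) N"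
  shows "function_norm M (\<lambda>f. N (ennreal_Lp_norm M f))"
proof -
  interpret N: function_norm "interval_measure_space a b" N by fact
  define J where "J = interval_measure_space a b"
  have J_p: "1 \<le> p" "0 < p" if "p \<in> space J" for p
    using that a by (auto simp: J_def einterval_def)
  have meas: "ennreal_Lp_norm M f \<in> borel_measurable J" if "f \<in> borel_measurable M" for f
    unfolding J_def using sf that by (rule borel_measurable_ennreal_Lp_norm)
  obtain c where c: "a < c" "ereal c < b"
    using ereal_dense2[OF ab] by auto
  have sub: "{a<..<c} \<subseteq> einterval (ereal a) b"
  proof
    fix p assume "p \<in> {a<..<c}"
    then have "ereal a < ereal p" "ereal p < ereal c" by auto
    then show "p \<in> einterval (ereal a) b"
      using less_trans[OF _ c(2), of "ereal p"] by (auto simp: einterval_def)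
  qed
  then have J_sets: "{a<..<c} \<in> sets J"
    by (simp add: J_def sets_restrict_space_iff)
  have J_emeasure: "emeasure J {a<..<c} = ennreal (c - a)"
    using sub c by (simp add: J_def emeasure_restrict_space)
  have J_pos: "emeasure J (space J) \<noteq> 0"
    using emeasure_space[of J "{a<..<c}"] J_emeasure c by auto
  show ?thesis
  proof
    fix f :: "'a \<Rightarrow> ennreal" assume f [measurable]: "f \<in> borel_measurable M"
    have "N (ennreal_Lp_norm M f) = 0 \<longleftrightarrow> (AE p in J. ennreal_Lp_norm M f p = 0)"
      using N.zero_iff meas[OF f] unfolding J_def by blast
    also have "\<dots> \<longleftrightarrow> (AE p in J. AE x in M. f x = 0)"
      by (simp add: ennreal_Lp_norm_eq_zero_iff)
    also have "\<dots> \<longleftrightarrow> (AE x in M. f x = 0)"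
      using J_pos by (simp add: eventually_const ae_filter_eq_bot_iff)
    finally show "N (ennreal_Lp_norm M f) = 0 \<longleftrightarrow> (AE x in M. f x = 0)" .
  next
    fix f :: "'a \<Rightarrow> ennreal" and r :: real assume f [measurable]: "f \<in> borel_measurable M" and r: "0 \<le> r"
    have "N (ennreal_Lp_norm M (\<lambda>x. ennreal r * f x)) = N (\<lambda>p. ennreal r * ennreal_Lp_norm M f p)"
      using J_p r meas unfolding J_def
      by (intro N.norm_cong_AE AE_I2 ennreal_Lp_norm_scale) auto
    also have "\<dots> = ennreal r * N (ennreal_Lp_norm M f)"
      using meas[OF f] r unfolding J_def by (intro N.scale) auto
    finally show "N (ennreal_Lp_norm M (\<lambda>x. ennreal r * f x)) = ennreal r * N (ennreal_Lp_norm M f)" .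
  next
    fix f g :: "'a \<Rightarrow> ennreal"
    assume f [measurable]: "f \<in> borel_measurable M" and g [measurable]: "g \<in> borel_measurable M"
    have "N (ennreal_Lp_norm M (\<lambda>x. f x + g x))
        \<le> N (\<lambda>p. ennreal_Lp_norm M f p + ennreal_Lp_norm M g p)"
      using J_p meas unfolding J_def
      by (intro N.mono AE_I2 ennreal_Lp_norm_triangle) auto
    also have "\<dots> \<le> N (ennreal_Lp_norm M f) + N (ennreal_Lp_norm M g)"
      using meas[OF f] meas[OF g] unfolding J_def by (intro N.triangle) auto
    finally show "N (ennreal_Lp_norm M (\<lambda>x. f x + g x))
        \<le> N (ennreal_Lp_norm M f) + N (ennreal_Lp_norm M g)" .
  next
    fix f g :: "'a \<Rightarrow> ennreal"
    assume f: "f \<in> borel_measurable M" and g: "g \<in> borel_measurable M"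
      and le: "AE x in M. f x \<le> g x"
    show "N (ennreal_Lp_norm M f) \<le> N (ennreal_Lp_norm M g)"
      using J_p meas[OF f] meas[OF g] unfolding J_def
      by (intro N.mono AE_I2 ennreal_Lp_norm_mono[OF le]) auto
  next
    fix F :: "nat \<Rightarrow> 'a \<Rightarrow> ennreal" and f assume F: "\<And>n. F n \<in> borel_measurable M" and f: "f \<in> borel_measurable M"
      and lim: "AE x in M. incseq (\<lambda>n. F n x) \<and> (\<lambda>n. F n x) \<longlonglongrightarrow> f x"
    show "incseq (\<lambda>n. N (ennreal_Lp_norm M (F n)))
        \<and> (\<lambda>n. N (ennreal_Lp_norm M (F n))) \<longlonglongrightarrow> N (ennreal_Lp_norm M f)"
      using J_p meas[OF F] meas[OF f] ennreal_Lp_norm_monotone_convergence[OF F _ lim]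
      unfolding J_def by (intro N.fatou AE_I2) auto
  next
    fix E assume E [measurable]: "E \<in> sets M" and fin: "emeasure M E < \<infinity>"
    obtain C :: real where C: "0 < C" and C_le: "\<And>h. h \<in> borel_measurable J
        \<Longrightarrow> (\<integral>\<^sup>+p\<in>{a<..<c}. h p \<partial>J) \<le> ennreal C * N h"
      using N.local_integrable[of "{a<..<c}"] J_sets J_emeasure unfolding J_def by auto
    define K where "K = 1 + measure M E"
    have K: "0 < K" "1 + emeasure M E = ennreal K"
      using fin by (auto simp: K_def add_pos_nonneg emeasure_eq_ennreal_measure less_top ennreal_plus)
    have "(\<integral>\<^sup>+x\<in>E. f x \<partial>M) \<le> ennreal (K * C / (c - a)) * N (ennreal_Lp_norm M f)"
      if f [measurable]: "f \<in> borel_measurable M" for f :: "'a \<Rightarrow> ennreal"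
    proof -
      note [measurable] = meas[OF f] J_sets
      define I where "I = (\<integral>\<^sup>+x\<in>E. f x \<partial>M)"
      have "I * ennreal (c - a) = (\<integral>\<^sup>+p\<in>{a<..<c}. I \<partial>J)"
        by (simp add: nn_integral_cmult J_emeasure)
      also have "\<dots> \<le> (\<integral>\<^sup>+p\<in>{a<..<c}. ennreal K * ennreal_Lp_norm M f p \<partial>J)"
        unfolding I_def K(2)[symmetric] using J_p
        by (intro nn_integral_mono mult_right_mono set_nn_integral_le_ennreal_Lp_norm) auto
      also have "\<dots> = ennreal K * (\<integral>\<^sup>+p\<in>{a<..<c}. ennreal_Lp_norm M f p \<partial>J)"
        by (simp add: mult.assoc nn_integral_cmult)
      also have "\<dots> \<le> ennreal K * (ennreal C * N (ennreal_Lp_norm M f))"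
        by (intro mult_left_mono C_le) auto
      finally have "ennreal (1 / (c - a)) * (I * ennreal (c - a))
          \<le> ennreal (1 / (c - a)) * (ennreal K * (ennreal C * N (ennreal_Lp_norm M f)))"
        by (intro mult_left_mono) auto
      moreover have "ennreal (1 / (c - a)) * (I * ennreal (c - a)) = I"
      proof -
        have "ennreal (1 / (c - a)) * (I * ennreal (c - a)) = I * ennreal (1 / (c - a) * (c - a))"
          using c by (subst ennreal_mult) (auto simp: mult_ac)
        then show ?thesis using c by simp
      qed
      moreover have "ennreal (1 / (c - a)) * (ennreal K * (ennreal C * N (ennreal_Lp_norm M f)))
          = ennreal (K * C / (c - a)) * N (ennreal_Lp_norm M f)"
        using c K(1) C by (simp add: ennreal_mult[symmetric] mult.assoc[symmetric])
      ultimately show ?thesis by (simp add: I_def)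
    qed
    moreover have "0 < K * C / (c - a)" using K(1) C c by simp
    ultimately show "\<exists>C::real. 0 < C \<and> (\<forall>f\<in>borel_measurable M.
        (\<integral>\<^sup>+x\<in>E. f x \<partial>M) \<le> ennreal C * N (ennreal_Lp_norm M f))"
      by blast
  qed
qed

section \<open>Rearrangement invariance and order continuity\<close>

lemma nn_integral_layer_cake:
  assumes "sigma_finite_measure M" and [measurable]: "h \<in> borel_measurable M" and nonneg: "\<And>x. 0 \<le> h x"
  shows "(\<integral>\<^sup>+x. ennreal (h x) \<partial>M) = (\<integral>\<^sup>+t\<in>{0..}. emeasure M {x \<in> space M. t < h x} \<partial>lborel)"
proof -
  interpret pair_sigma_finite M lborel
    using assms(1) by (simp add: pair_sigma_finite_def lborel.sigma_finite_measure_axioms)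
  have "(\<integral>\<^sup>+x. ennreal (h x) \<partial>M) = (\<integral>\<^sup>+x. \<integral>\<^sup>+t. indicator {0..<h x} t \<partial>lborel \<partial>M)"
    using nonneg by simp
  also have "\<dots> = (\<integral>\<^sup>+x. \<integral>\<^sup>+t. (if 0 \<le> t \<and> t < h x then 1 else 0) \<partial>lborel \<partial>M)"
    by (intro nn_integral_cong) (auto split: split_indicator)
  also have "\<dots> = (\<integral>\<^sup>+t. \<integral>\<^sup>+x. (if 0 \<le> t \<and> t < h x then 1 else 0) \<partial>M \<partial>lborel)"
    by (rule Fubini'[symmetric]) measurable
  also have "\<dots> = (\<integral>\<^sup>+t\<in>{0..}. emeasure M {x \<in> space M. t < h x} \<partial>lborel)"
  proof (rule nn_integral_cong)
    fix t :: real
    have "(\<integral>\<^sup>+x. (if 0 \<le> t \<and> t < h x then 1 else 0) \<partial>M)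
        = (\<integral>\<^sup>+x. indicator {0..} t * indicator {x \<in> space M. t < h x} x \<partial>M)"
      by (intro nn_integral_cong) (auto split: split_indicator)
    also have "\<dots> = indicator {0..} t * emeasure M {x \<in> space M. t < h x}"
      by (simp add: nn_integral_cmult)
    finally show "(\<integral>\<^sup>+x. (if 0 \<le> t \<and> t < h x then 1 else 0) \<partial>M)
        = emeasure M {x \<in> space M. t < h x} * indicator {0..} t"
      by (simp add: mult.commute)
  qed
  finally show ?thesis .
qed

text \<open>By the layer cake formula the Lebesgue norms only depend on the distribution function.\<close>

lemma Lp_norm_cong_equimeasurable:
  assumes sf: "sigma_finite_measure M" and "equimeasurable M f g" and p: "0 < p"
    and [measurable]: "f \<in> borel_measurable M" "g \<in> borel_measurable M"
  shows "Lp_norm M f p = Lp_norm M g p"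
proof -
  have level: "{x \<in> space M. t < \<bar>h x\<bar> powr p} = {x \<in> space M. t powr (1 / p) < \<bar>h x\<bar>}"
    if "0 \<le> t" for t and h :: "'a \<Rightarrow> real"
  proof -
    have "t < u powr p \<longleftrightarrow> t powr (1 / p) < u" if "0 \<le> u" for u
    proof -
      have "t powr (1 / p) < u \<longleftrightarrow> (t powr (1 / p)) powr p < u powr p"
        using that p powr_less_mono2[of p "t powr (1 / p)" u] powr_mono2[of p u "t powr (1 / p)"]
        by fastforce
      then show ?thesis using \<open>0 \<le> t\<close> p by (simp add: powr_powr)
    qed
    then show ?thesis by auto
  qed
  have "(\<integral>\<^sup>+x. ennreal (\<bar>f x\<bar> powr p) \<partial>M)
      = (\<integral>\<^sup>+t\<in>{0..}. emeasure M {x \<in> space M. t < \<bar>f x\<bar> powr p} \<partial>lborel)"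
    using sf by (rule nn_integral_layer_cake) auto
  also have "\<dots> = (\<integral>\<^sup>+t\<in>{0..}. emeasure M {x \<in> space M. t < \<bar>g x\<bar> powr p} \<partial>lborel)"
  proof (rule nn_integral_cong)
    fix t :: real
    show "emeasure M {x \<in> space M. t < \<bar>f x\<bar> powr p} * indicator {0..} t
        = emeasure M {x \<in> space M. t < \<bar>g x\<bar> powr p} * indicator {0..} t"
      using assms(2) level[of t f] level[of t g]
      by (cases "0 \<le> t") (simp_all add: equimeasurable_def)
  qed
  also have "\<dots> = (\<integral>\<^sup>+x. ennreal (\<bar>g x\<bar> powr p) \<partial>M)"
    using sf by (rule nn_integral_layer_cake[symmetric]) auto
  finally show ?thesis by (simp add: Lp_norm_def)
qed

lemma tendsto_zero_ennreal_power:
  assumes lim: "(F \<longlongrightarrow> 0) A" and r: "0 < r"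
  shows "((\<lambda>n. ennreal_power (F n) r) \<longlongrightarrow> 0) A"
proof (rule order_tendstoI)
  fix y :: ennreal assume "0 < y"
  then have "0 < ennreal_power y (1 / r)" by (simp add: zero_less_iff_neq_zero)
  then have "\<forall>\<^sub>F n in A. F n < ennreal_power y (1 / r)"
    using order_tendstoD(2)[OF lim] by blast
  then show "\<forall>\<^sub>F n in A. ennreal_power (F n) r < y"
  proof eventually_elim
    fix n assume less: "F n < ennreal_power y (1 / r)"
    show "ennreal_power (F n) r < y"
    proof (rule ccontr)
      assume "\<not> ennreal_power (F n) r < y"
      then have "ennreal_power y (1 / r) \<le> ennreal_power (ennreal_power (F n) r) (1 / r)"
        using r by (intro ennreal_power_mono) auto
      then show False using less r by (simp add: ennreal_power_inverse)
    qed
  qed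
qed simp

lemma Lp_norm_mono:
  assumes "AE x in M. \<bar>f x\<bar> \<le> \<bar>g x\<bar>" "0 < p"
  shows "Lp_norm M f p \<le> Lp_norm M g p"
  unfolding Lp_norm_eq_ennreal_Lp_norm using assms
  by (intro ennreal_Lp_norm_mono) (auto elim!: eventually_mono intro: ennreal_leI)

lemma Lp_norm_tendsto_zero:
  fixes g :: "nat \<Rightarrow> 'a \<Rightarrow> real"
  assumes [measurable]: "\<And>n. g n \<in> borel_measurable M"
    and bound: "\<And>n. AE x in M. \<bar>g n x\<bar> \<le> \<bar>g 0 x\<bar>"
    and lim: "AE x in M. (\<lambda>n. g n x) \<longlonglongrightarrow> 0"
    and p: "0 < p" and fin: "Lp_norm M (g 0) p < \<infinity>"
  shows "(\<lambda>n. Lp_norm M (g n) p) \<longlonglongrightarrow> 0"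
proof -
  have "(\<lambda>n. \<integral>\<^sup>+x. norm (0 - \<bar>g n x\<bar> powr p) \<partial>M) \<longlonglongrightarrow> 0"
  proof (rule nn_integral_dominated_convergence_norm[where w = "\<lambda>x. \<bar>g 0 x\<bar> powr p"])
    show "AE x in M. norm (\<bar>g n x\<bar> powr p) \<le> \<bar>g 0 x\<bar> powr p" for n
      using bound[of n] p by (auto elim!: eventually_mono intro: powr_mono2)
    show "(\<integral>\<^sup>+x. ennreal (\<bar>g 0 x\<bar> powr p) \<partial>M) < \<infinity>"
      using fin by (simp add: Lp_norm_def flip: top.not_eq_extremum)
    show "AE x in M. (\<lambda>n. \<bar>g n x\<bar> powr p) \<longlonglongrightarrow> 0"
      using lim
    proof eventually_elim
      fix x assume "(\<lambda>n. g n x) \<longlonglongrightarrow> 0"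
      then have "(\<lambda>n. \<bar>g n x\<bar>) \<longlonglongrightarrow> 0" by (rule tendsto_rabs_zero)
      then show "(\<lambda>n. \<bar>g n x\<bar> powr p) \<longlonglongrightarrow> 0"
        using p by (intro tendsto_zero_powrI) auto
    qed
  qed auto
  then show ?thesis
    unfolding Lp_norm_def using p by (intro tendsto_zero_ennreal_power) auto
qed

text \<open>
  If \<open>g n\<close> decreases to \<open>0\<close>, then so does \<open>Lp_norm M (g n) p\<close> for every \<open>p\<close> at which
  \<open>Lp_norm M (g 0) p\<close> is finite, by dominated convergence. Finiteness of the composed norm of
  \<open>g 0\<close> makes this almost every \<open>p\<close>, and the order continuity of \<open>N\<close> applies to these functions of
  the exponent, with the value \<open>\<infinity>\<close> replaced by \<open>0\<close>.
\<close>

lemma order_continuous_CGLS: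
  assumes sf: "sigma_finite_measure M" and a: "1 \<le> a"
    and N: "function_norm (interval_measure_space a b) N"
    and oc: "order_continuous (interval_measure_space a b)
      (fn_space (interval_measure_space a b) N) (fn_norm N)"
  shows "order_continuous M (CGLS M N) (CGLS_norm M N)"
  unfolding order_continuous_def
proof (intro allI impI, elim conjE)
  define J where "J = interval_measure_space a b"
  interpret N: function_norm J N using N by (simp add: J_def)
  fix g :: "nat \<Rightarrow> 'a \<Rightarrow> real"
  assume X: "\<forall>n. g n \<in> CGLS M N"
    and lim: "AE x in M. decseq (\<lambda>n. g n x) \<and> (\<lambda>n. g n x) \<longlonglongrightarrow> 0"
  have g [measurable]: "g n \<in> borel_measurable M" and fin: "N (Lp_norm M (g n)) < \<infinity>" for n
    using X by (auto simp: CGLS_def CGLS_norm_def)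
  have J_p: "0 < p" if "p \<in> space J" for p
    using that a by (auto simp: J_def einterval_def)
  have meas [measurable]: "Lp_norm M (g n) \<in> borel_measurable J" for n
    unfolding J_def Lp_norm_eq_ennreal_Lp_norm
    by (rule borel_measurable_ennreal_Lp_norm[OF sf]) simp
  have abs_mono: "AE x in M. \<bar>g n x\<bar> \<le> \<bar>g m x\<bar>" if "m \<le> n" for m n
    using lim
  proof eventually_elim
    fix x assume *: "decseq (\<lambda>n. g n x) \<and> (\<lambda>n. g n x) \<longlonglongrightarrow> 0"
    then have "0 \<le> g n x" "g n x \<le> g m x"
      using decseq_ge[of "\<lambda>n. g n x" 0 n] that by (auto simp: decseq_def)
    then show "\<bar>g n x\<bar> \<le> \<bar>g m x\<bar>" by simp
  qed
  define h where "h n p = enn2real (Lp_norm M (g n) p)" for n p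
  have h [measurable]: "h n \<in> borel_measurable J" for n unfolding h_def by measurable
  have finite_p: "AE p in J. \<forall>n. Lp_norm M (g n) p < \<infinity>"
    using N.finite_norm_imp_AE_finite[OF meas fin] by (simp add: AE_all_countable)
  have norm_h: "fn_norm N (h n) = CGLS_norm M N (g n)" for n
    unfolding fn_norm_def CGLS_norm_def
  proof (rule N.norm_cong_AE)
    show "AE p in J. ennreal \<bar>h n p\<bar> = Lp_norm M (g n) p"
      using finite_p by eventually_elim (simp add: h_def)
  qed auto
  have h_space: "h n \<in> fn_space J N" for n
    using fin[of n] norm_h[of n] by (simp add: fn_space_def CGLS_norm_def)
  have "AE p in J. decseq (\<lambda>n. h n p) \<and> (\<lambda>n. h n p) \<longlonglongrightarrow> 0"
    using finite_p AE_space
  proof eventually_elim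
    fix p assume finp: "\<forall>n. Lp_norm M (g n) p < \<infinity>" and "p \<in> space J"
    then have p: "0 < p" using J_p by blast
    have "decseq (\<lambda>n. h n p)"
      unfolding decseq_def h_def
      using finp p abs_mono by (auto intro!: enn2real_mono Lp_norm_mono)
    moreover have "(\<lambda>n. Lp_norm M (g n) p) \<longlonglongrightarrow> 0"
    proof (rule Lp_norm_tendsto_zero)
      show "AE x in M. (\<lambda>n. g n x) \<longlonglongrightarrow> 0" using lim by (auto elim: eventually_mono)
    qed (use finp p abs_mono in auto)
    then have "(\<lambda>n. h n p) \<longlonglongrightarrow> enn2real 0"
      unfolding h_def by (intro tendsto_enn2real) auto
    ultimately show "decseq (\<lambda>n. h n p) \<and> (\<lambda>n. h n p) \<longlonglongrightarrow> 0" by simp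
  qed
  then have "decseq (\<lambda>n. fn_norm N (h n)) \<and> (\<lambda>n. fn_norm N (h n)) \<longlonglongrightarrow> 0"
    using oc h_space unfolding order_continuous_def J_def by blast
  then show "decseq (\<lambda>n. CGLS_norm M N (g n)) \<and> (\<lambda>n. CGLS_norm M N (g n)) \<longlonglongrightarrow> 0"
    by (simp add: norm_h)
qed

lemma rearrangement_invariant_CGLS:
  assumes sf: "sigma_finite_measure M" and a: "1 \<le> a"
    and N: "function_norm (interval_measure_space a b) N"
  shows "rearrangement_invariant M (CGLS M N) (CGLS_norm M N)"
  unfolding rearrangement_invariant_def
proof (intro ballI impI)
  interpret N: function_norm "interval_measure_space a b" N by fact
  fix f g assume f: "f \<in> CGLS M N" and g [measurable]: "g \<in> borel_measurable M"
    and eq: "equimeasurable M f g"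
  have f_meas [measurable]: "f \<in> borel_measurable M" using f by (simp add: CGLS_def)
  have "CGLS_norm M N g = CGLS_norm M N f"
    unfolding CGLS_norm_def
  proof (rule N.norm_cong_AE)
    show "AE p in interval_measure_space a b. Lp_norm M g p = Lp_norm M f p"
      using a by (intro AE_I2 Lp_norm_cong_equimeasurable[OF sf eq _ f_meas g, symmetric])
        (auto simp: einterval_def)
  qed (auto simp: Lp_norm_eq_ennreal_Lp_norm intro!: borel_measurable_ennreal_Lp_norm sf)
  then show "g \<in> CGLS M N \<and> CGLS_norm M N g = CGLS_norm M N f"
    using f by (simp add: CGLS_def)
qed

section \<open>Indicator functions\<close>

text \<open>The norm of order \<open>p \<ge> 1\<close> of an indicator is at most \<open>max 1 (\<mu> E)\<close>, uniformly in \<open>p\<close>.\<close>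

lemma indicator_in_CGLS:
  assumes sf: "sigma_finite_measure M" and a: "1 \<le> a"
    and N: "function_norm (interval_measure_space a b) N"
    and one: "N (\<lambda>p. 1) < \<infinity>" and E [measurable]: "E \<in> sets M" and fin: "emeasure M E < \<infinity>"
  shows "indicat_real E \<in> CGLS M N"
proof -
  interpret N: function_norm "interval_measure_space a b" N by fact
  define K where "K = max 1 (measure M E)"
  have K: "1 \<le> K" by (simp add: K_def)
  have le: "Lp_norm M (indicat_real E) p \<le> ennreal K" if "1 \<le> p" for p
  proof -
    have "(\<integral>\<^sup>+x. ennreal_power (ennreal \<bar>indicat_real E x\<bar>) p \<partial>M) = (\<integral>\<^sup>+x. indicator E x \<partial>M)"
      by (intro nn_integral_cong) (auto simp: ennreal_power_def split: split_indicator)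
    also have "\<dots> = ennreal (measure M E)"
      using fin by (simp add: emeasure_eq_ennreal_measure less_top)
    also have "\<dots> \<le> ennreal (K powr p)"
      using powr_mono[OF that K] by (intro ennreal_leI) (simp add: K_def)
    finally show ?thesis
      using that K by (simp add: Lp_norm_eq_ennreal_Lp_norm ennreal_Lp_norm_le_iff)
  qed
  have "N (Lp_norm M (indicat_real E)) \<le> N (\<lambda>p. ennreal K * 1)"
  proof (rule N.mono)
    show "AE p in interval_measure_space a b. Lp_norm M (indicat_real E) p \<le> ennreal K * 1"
      using a le by (intro AE_I2) (auto simp: einterval_def)
  qed (auto simp: Lp_norm_eq_ennreal_Lp_norm intro!: borel_measurable_ennreal_Lp_norm sf)
  also have "\<dots> = ennreal K * N (\<lambda>p. 1)"
    using K by (intro N.scale) auto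
  also have "\<dots> < \<infinity>" using one by (simp add: ennreal_mult_less_top)
  finally show ?thesis by (simp add: CGLS_def CGLS_norm_def)
qed

section \<open>Composed Grand Lebesgue Spaces\<close>

theorem theorem1p1:
  fixes M :: "'a measure" and a :: real and b :: ereal and N :: "(real \<Rightarrow> ennreal) \<Rightarrow> ennreal"
  assumes "sigma_finite_measure M" and "emeasure M (space M) \<noteq> 0"
    and "1 \<le> a" and "ereal a < b"
    and "function_norm (interval_measure_space a b) N"
    and "rearrangement_invariant (interval_measure_space a b)
           (fn_space (interval_measure_space a b) N) (fn_norm N)"
    and "order_continuous (interval_measure_space a b)
           (fn_space (interval_measure_space a b) N) (fn_norm N)"
  shows "banach_function_space M (CGLS M N) (CGLS_norm M N)
    \<and> norm_complete (CGLS M N) (CGLS_norm M N)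
    \<and> order_continuous M (CGLS M N) (CGLS_norm M N)
    \<and> rearrangement_invariant M (CGLS M N) (CGLS_norm M N)
    \<and> fatou_property M (CGLS_norm M N)
    \<and> (N (\<lambda>p. 1) < \<infinity> \<longrightarrow>
         (\<forall>E\<in>sets M. emeasure M E < \<infinity> \<longrightarrow> indicat_real E \<in> CGLS M N))"
proof -
  define \<rho> where "\<rho> f = N (ennreal_Lp_norm M f)" for f
  interpret \<rho>: function_norm M \<rho>
    using function_norm_composed[OF assms(1,3,4,5)] by (simp add: \<rho>_def[abs_def])
  have norm_eq: "CGLS_norm M N = fn_norm \<rho>"
    by (simp add: fun_eq_iff CGLS_norm_def fn_norm_def \<rho>_def Lp_norm_eq_ennreal_Lp_norm)
  have space_eq: "CGLS M N = fn_space M \<rho>"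
    by (simp add: CGLS_def fn_space_def norm_eq)
  have "banach_function_space M (CGLS M N) (CGLS_norm M N)"
    unfolding banach_function_space_def norm_eq space_eq
    using \<rho>.function_norm_axioms by blast
  moreover have "norm_complete (CGLS M N) (CGLS_norm M N)"
    unfolding norm_eq space_eq by (rule \<rho>.norm_complete_fn_space)
  moreover have "fatou_property M (CGLS_norm M N)"
    unfolding norm_eq by (rule \<rho>.fatou_property_fn_norm)
  ultimately show ?thesis
    using order_continuous_CGLS[OF assms(1,3,5,7)] rearrangement_invariant_CGLS[OF assms(1,3,5)]
      indicator_in_CGLS[OF assms(1,3,5)] by blast
qed

end
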